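(* Let $G$ and $H$ be block graphs, neither of which has a simplicial vertex of degree at least $2$. If $G$ and $H$ are locally equivalent, then $G$ and $H$ are isomorphic.
   Context: Graphs are finite and simple. A block of a graph is a maximal connected subgraph without cut-vertices. A graph is a block graph if every block of it is a complete graph. A vertex is simplicial if its set of neighbors is a clique. The local complementation at a vertex $v$ of $G$ replaces the induced subgraph of $G$ on the neighborhood of $v$ by its complement. Two graphs are locally equivalent if one can be obtained from the other by a sequence of local complementations. *)

theory Defs
  imports "Graph_Theory.Graph_Theory"
begin

text \<open>
  A finite simple graph is a \<^locale>\<open>pair_graph\<close>: a finite, loop-free, symmetric digraph without
  parallel arcs, where an edge \<open>uv\<close> is represented by the two arcs \<open>(u,v)\<close> and \<open>(v,u)\<close>.
\<close>

text \<open>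
  In a symmetric digraph, the members of \<^const>\<open>pre_digraph.sccs\<close> are the connected components.
\<close>

definition cut_vertex :: "('a,'b) pre_digraph \<Rightarrow> 'a \<Rightarrow> bool" where
  "cut_vertex G v \<longleftrightarrow> v \<in> verts G \<and>
     card (pre_digraph.sccs (pre_digraph.del_vert G v)) > card (pre_digraph.sccs G)"

text \<open>
  A subgraph in the sense of \<^const>\<open>subgraph\<close> need not be symmetric, hence the requirement
  \<open>graph B\<close>. \<^const>\<open>connected\<close> excludes the graph without vertices.
\<close>

definition block :: "('a,'b) pre_digraph \<Rightarrow> ('a,'b) pre_digraph \<Rightarrow> bool" where
  "block G B \<longleftrightarrow>
     pre_digraph.max_subgraph G (\<lambda>B. graph B \<and> connected B \<and> \<not> (\<exists>v. cut_vertex B v)) B"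

definition block_graph :: "('a,'b) pre_digraph \<Rightarrow> bool" where
  "block_graph G \<longleftrightarrow> graph G \<and> (\<forall>B. block G B \<longrightarrow> (\<exists>n. complete_digraph n B))"

definition neighbors :: "('a,'b) pre_digraph \<Rightarrow> 'a \<Rightarrow> 'a set" where
  "neighbors G v = {u. v \<rightarrow>\<^bsub>G\<^esub> u}"

definition clique :: "('a,'b) pre_digraph \<Rightarrow> 'a set \<Rightarrow> bool" where
  "clique G S \<longleftrightarrow> S \<subseteq> verts G \<and> (\<forall>x\<in>S. \<forall>y\<in>S. x \<noteq> y \<longrightarrow> x \<rightarrow>\<^bsub>G\<^esub> y)"

definition simplicial :: "('a,'b) pre_digraph \<Rightarrow> 'a \<Rightarrow> bool" where
  "simplicial G v \<longleftrightarrow> v \<in> verts G \<and> clique G (neighbors G v)"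

definition degree :: "('a,'b) pre_digraph \<Rightarrow> 'a \<Rightarrow> nat" where
  "degree G v = card (neighbors G v)"

definition local_complement :: "'a pair_pre_digraph \<Rightarrow> 'a \<Rightarrow> 'a pair_pre_digraph" where
  "local_complement G v =
     \<lparr> pverts = pverts G,
       parcs = {(x,y) \<in> parcs G. \<not> (x \<in> neighbors G v \<and> y \<in> neighbors G v)} \<union>
               {(x,y). x \<in> neighbors G v \<and> y \<in> neighbors G v \<and> x \<noteq> y \<and> (x,y) \<notin> parcs G} \<rparr>"

definition locally_equivalent :: "'a pair_pre_digraph \<Rightarrow> 'a pair_pre_digraph \<Rightarrow> bool" where
  "locally_equivalent = (\<lambda>G H. \<exists>v \<in> pverts G. H = local_complement G v)\<^sup>*\<^sup>*"

end

theory Submission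
  imports Defs
begin

text \<open>
  The cut-rank of a vertex set is invariant under local complementation, and it determines the graph
  up to isomorphism. Call two vertices equivalent if they are equal, or non-isolated and together of
  cut-rank at most 1. Since a block graph without simplicial vertices of degree at least 2 has no
  twins other than leaves at a common neighbour, the equivalence classes are the stars formed by a
  vertex (the center) and the leaves attached to it. All edges between different classes join centers.
  Two centers in the same component are non-adjacent iff some cut vertex \<open>x\<close> separates them, and this
  happens iff there are a set \<open>X\<close> and a non-isolated vertex \<open>x\<close> such that \<open>X\<close> and \<open>X \<union> {x}\<close> both have
  cut-rank at most 1, one class lies in \<open>X\<close> and the other one outside \<open>X \<union> {x}\<close>. So \<open>G\<close> and \<open>H\<close> have
  the same classes and the same adjacencies between classes, and exchanging in every class the center
  in \<open>G\<close> with the center in \<open>H\<close> is an isomorphism.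
\<close>

section \<open>Block graphs determined by their cut-rank\<close>

text \<open>The cut-rank over GF(2) is 0 for \<open>edge_closed\<close> sets and at most 1 for \<open>split_set\<close>s.\<close>

definition edge_closed :: "'a rel \<Rightarrow> 'a set \<Rightarrow> bool" where
  "edge_closed E X \<longleftrightarrow> (\<forall>a\<in>X. \<forall>b. (a, b) \<in> E \<longrightarrow> b \<in> X)"

definition split_set :: "'a rel \<Rightarrow> 'a set \<Rightarrow> bool" where
  "split_set E X \<longleftrightarrow> (\<forall>a\<in>X. \<forall>a'\<in>X. \<forall>b. \<forall>b'. b \<notin> X \<and> b' \<notin> X \<and> (a, b) \<in> E \<and> (a', b') \<in> E
     \<longrightarrow> (a, b') \<in> E)"

definition same_star :: "'a rel \<Rightarrow> 'a \<Rightarrow> 'a \<Rightarrow> bool" where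
  "same_star E u v \<longleftrightarrow> u = v \<or> (\<not> edge_closed E {u} \<and> \<not> edge_closed E {v} \<and> split_set E {u, v})"

definition avoiding :: "'a rel \<Rightarrow> 'a \<Rightarrow> 'a rel" where
  "avoiding E e = {(x, y) \<in> E. x \<noteq> e \<and> y \<noteq> e}"

text \<open>The first disjunct covers stars in different components, the second those parted by a
  cut vertex \<open>x\<close>. As in \<open>same_star\<close>, only \<open>edge_closed\<close> and
  \<open>split_set\<close> refer to \<open>E\<close>, so every invariance of these two carries
  over.\<close>

definition separated :: "'a rel \<Rightarrow> 'a set \<Rightarrow> 'a set \<Rightarrow> bool" where
  "separated E C D \<longleftrightarrow> (\<exists>X. edge_closed E X \<and> C \<subseteq> X \<and> D \<inter> X = {}) \<or>
     (\<exists>x X. \<not> edge_closed E {x} \<and> x \<notin> X \<and> split_set E X \<and> split_set E (insert x X) \<and>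
        C \<subseteq> X \<and> D \<inter> insert x X = {})"

text \<open>A singleton class is its own center. A class that forms a two-vertex component has two
  centers, hence the choice in \<open>center\<close>.\<close>

definition is_center :: "'a rel \<Rightarrow> 'a set \<Rightarrow> 'a \<Rightarrow> bool" where
  "is_center E K c \<longleftrightarrow> c \<in> K \<and> (\<forall>w\<in>K. w \<noteq> c \<longrightarrow> E `` {w} = {c})"

definition center :: "'a rel \<Rightarrow> 'a set \<Rightarrow> 'a" where
  "center E K = (SOME c. is_center E K c)"

text \<open>\<open>cycle_chord\<close> is the form in which completeness of blocks enters:
  \<open>e\<close> closes the path from \<open>c\<close> to \<open>z\<close> to a cycle, and a cycle
  lies in one block. There is no vertex set, so an isolated vertex is just one without an
  edge.\<close>

locale block_relation =
  fixes E :: "'a rel"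
  assumes sym: "(x, y) \<in> E \<Longrightarrow> (y, x) \<in> E"
    and irrefl: "(x, x) \<notin> E"
    and cycle_chord: "\<lbrakk>(e, c) \<in> E; (e, z) \<in> E; c \<noteq> z; (c, z) \<in> (avoiding E e)\<^sup>*\<rbrakk> \<Longrightarrow> (c, z) \<in> E"
    and nonsimplicial: "\<lbrakk>(x, y) \<in> E; (x, z) \<in> E; y \<noteq> z\<rbrakk> \<Longrightarrow>
      \<exists>u v. (x, u) \<in> E \<and> (x, v) \<in> E \<and> u \<noteq> v \<and> (u, v) \<notin> E"
begin

section \<open>Stars as classes of vertices\<close>

lemma four_cycle_chord:
  assumes "(a, b) \<in> E" "(b, c) \<in> E" "(c, d) \<in> E" "(d, a) \<in> E" "a \<noteq> c" "b \<noteq> d"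
  shows "(a, c) \<in> E"
proof (rule cycle_chord)
  have "(a, d) \<in> avoiding E b" "(d, c) \<in> avoiding E b"
    using assms irrefl sym unfolding avoiding_def by auto
  then show "(a, c) \<in> (avoiding E b)\<^sup>*" by auto
qed (use assms sym in auto)

lemma leaf_nbr_iff: "E `` {u} = {b} \<longleftrightarrow> (u, b) \<in> E \<and> (\<forall>w. (u, w) \<in> E \<longrightarrow> w = b)"
  by auto

text \<open>Two non-isolated vertices of joint cut-rank at most 1 that fit none of the three shapes
  are twins with at least two neighbours. Chords of four-cycles then make the neighbourhood of
  \<open>u\<close> a clique, against \<open>nonsimplicial\<close>.\<close>

lemma same_star_iff:
  assumes "u \<noteq> v"
  shows "same_star E u v \<longleftrightarrow>
    E `` {u} = {v} \<or> E `` {v} = {u} \<or> (\<exists>b. E `` {u} = {b} \<and> E `` {v} = {b})"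
    (is "_ \<longleftrightarrow> ?R")
proof
  assume "same_star E u v"
  with assms have ne: "E `` {u} \<noteq> {}" "E `` {v} \<noteq> {}" and sp: "split_set E {u, v}"
    by (auto simp: same_star_def edge_closed_def)
  show ?R
  proof (rule ccontr)
    assume nR: "\<not> ?R"
    then obtain b b' where b: "(u, b) \<in> E" "b \<noteq> v" and b': "(v, b') \<in> E" "b' \<noteq> u"
      using ne by auto
    have "b \<noteq> u" "b' \<noteq> v" using b b' irrefl by auto
    \<comment> \<open>The rows of \<open>u\<close> and \<open>v\<close> in the cut matrix are
      nonzero, by \<open>b\<close> and \<open>b'\<close>; cut-rank at most 1 forces them to be
      equal.\<close>
    then have same: "(u, w) \<in> E \<longleftrightarrow> (v, w) \<in> E" if "w \<noteq> u" "w \<noteq> v" for w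
      using sp that b b' unfolding split_set_def by blast
    have vb: "(v, b) \<in> E" using same[of b] b \<open>b \<noteq> u\<close> by blast
    \<comment> \<open>Otherwise \<open>u\<close> and \<open>v\<close> are both leaves at
      \<open>b\<close>, which is the third shape.\<close>
    have ex: "\<exists>y. (u, y) \<in> E \<and> y \<noteq> b"
    proof (rule ccontr)
      assume "\<not> ?thesis"
      then have only: "y = b" if "(u, y) \<in> E" for y using that by blast
      then have "y = b" if "(v, y) \<in> E" for y
        using that same[of y] irrefl sym b by metis
      then have "E `` {u} = {b}" "E `` {v} = {b}" unfolding leaf_nbr_iff using b vb only by blast+
      then show False using nR by blast
    qed
    \<comment> \<open>The four-cycle \<open>y\<close>, \<open>u\<close>, \<open>z\<close>,
      \<open>v\<close> has the chord \<open>yz\<close>.\<close>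
    have pair: "(y, z) \<in> E" if "(u, y) \<in> E" "(u, z) \<in> E" "y \<noteq> z" "y \<noteq> v" "z \<noteq> v" for y z
      using four_cycle_chord[of y u z v] that same[of y] same[of z] irrefl sym assms by metis
    have v: "(v, z) \<in> E" if "(u, z) \<in> E" "z \<noteq> v" for z
      using that same[of z] irrefl by metis
    from ex obtain y z where "(u, y) \<in> E" "(u, z) \<in> E" "y \<noteq> z" "(y, z) \<notin> E"
      using nonsimplicial b by metis
    then show False using pair v sym by metis
  qed
next
  assume ?R
  then consider "E `` {u} = {v}" | "E `` {v} = {u}" | b where "E `` {u} = {b}" "E `` {v} = {b}"
    by blast
  then show "same_star E u v"
  proof cases
    case 1
    then have "(u, v) \<in> E" "(v, u) \<in> E" "\<And>w. (u, w) \<in> E \<Longrightarrow> w = v" using sym by auto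
    then show ?thesis using assms unfolding same_star_def edge_closed_def split_set_def by blast
  next
    case 2
    then have "(u, v) \<in> E" "(v, u) \<in> E" "\<And>w. (v, w) \<in> E \<Longrightarrow> w = u" using sym by auto
    then show ?thesis using assms unfolding same_star_def edge_closed_def split_set_def by blast
  next
    case 3
    then have "(u, b) \<in> E" "(v, b) \<in> E" "b \<noteq> u" "b \<noteq> v"
      "\<And>w. (u, w) \<in> E \<Longrightarrow> w = b" "\<And>w. (v, w) \<in> E \<Longrightarrow> w = b"
      using irrefl by auto
    then show ?thesis unfolding same_star_def edge_closed_def split_set_def by blast
  qed
qed

lemma same_star_refl: "same_star E u u"
  by (simp add: same_star_def)

lemma same_star_commute: "same_star E u v \<longleftrightarrow> same_star E v u"
  by (auto simp: same_star_def insert_commute)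

text \<open>By \<open>same_star_iff\<close> each hypothesis is one of three shapes. Since a leaf has
  only one neighbour, any two shapes sharing \<open>v\<close> either combine to a shape for
  \<open>u\<close> and \<open>w\<close> or contradict distinctness.\<close>

lemma same_star_trans:
  assumes "same_star E u v" "same_star E v w" shows "same_star E u w"
proof (cases "u = v \<or> v = w \<or> u = w")
  case True
  then show ?thesis using assms same_star_refl by auto
next
  case False
  then have uv: "E `` {u} = {v} \<or> E `` {v} = {u} \<or> (\<exists>b. E `` {u} = {b} \<and> E `` {v} = {b})"
    and vw: "E `` {v} = {w} \<or> E `` {w} = {v} \<or> (\<exists>b. E `` {v} = {b} \<and> E `` {w} = {b})"
    using assms same_star_iff by auto
  have nbr: "(x, y) \<in> E" "(y, x) \<in> E" if "E `` {x} = {y}" for x y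
    using that sym by auto
  have uniq: "z = y" if "E `` {x} = {y}" "(x, z) \<in> E" for x y z
    using that by auto
  have "E `` {u} = {w} \<or> E `` {w} = {u} \<or> (\<exists>b. E `` {u} = {b} \<and> E `` {w} = {b})"
    using uv
  proof (elim disjE exE conjE)
    assume a: "E `` {u} = {v}"
    show ?thesis using vw
    proof (elim disjE exE conjE)
      assume "E `` {v} = {w}"
      then show ?thesis using uniq nbr(2)[OF a] False by blast
    next
      assume "E `` {w} = {v}"
      then show ?thesis using a by blast
    next
      fix b assume "E `` {v} = {b}" "E `` {w} = {b}"
      then show ?thesis using uniq nbr(2)[OF a] by metis
    qed
  next
    assume a: "E `` {v} = {u}"
    show ?thesis using vw
    proof (elim disjE exE conjE)
      assume "E `` {v} = {w}"
      then show ?thesis using uniq nbr(1)[OF a] False by blast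
    next
      assume "E `` {w} = {v}"
      then show ?thesis using uniq[OF a] nbr(2) False by metis
    next
      fix b assume "E `` {v} = {b}" "E `` {w} = {b}"
      then show ?thesis using uniq nbr(1)[OF a] by metis
    qed
  next
    fix b assume a: "E `` {u} = {b}" "E `` {v} = {b}"
    show ?thesis using vw
    proof (elim disjE exE conjE)
      assume "E `` {v} = {w}"
      then show ?thesis using uniq nbr(1)[OF a(2)] a by metis
    next
      assume "E `` {w} = {v}"
      then show ?thesis using a uniq[OF a(2)] nbr(2) by metis
    next
      fix b' assume "E `` {v} = {b'}" "E `` {w} = {b'}"
      then show ?thesis using uniq nbr(1)[OF a(2)] a by metis
    qed
  qed
  then show ?thesis using False same_star_iff[of u w] by blast
qed

lemma same_star_class_eq:
  assumes "same_star E u v" shows "{w. same_star E u w} = {w. same_star E v w}"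
  using assms same_star_trans same_star_commute by blast

text \<open>By \<open>same_star_iff\<close> a class with two members contains a leaf, and the
  neighbour of that leaf is a center.\<close>

lemma ex_center: "\<exists>c. is_center E {w. same_star E u w} c"
proof -
  have leaf: "is_center E {w. same_star E v w} v" if "E `` {u} = {v}" for u v
  proof -
    have "E `` {w} = {v}" if "same_star E v w" "w \<noteq> v" for w
      using same_star_iff[of v w] \<open>E `` {u} = {v}\<close> sym that unfolding leaf_nbr_iff by metis
    then show ?thesis by (auto simp: is_center_def same_star_refl)
  qed
  show ?thesis
  proof (cases "\<exists>v. same_star E u v \<and> v \<noteq> u")
    case False
    then have "{w. same_star E u w} = {u}" using same_star_refl by auto
    then show ?thesis by (auto simp: is_center_def)
  next
    case True
    then obtain v where v: "same_star E u v" "v \<noteq> u" by blast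
    then consider b where "E `` {u} = {b}" | "E `` {v} = {u}"
      using same_star_iff[of u v] by metis
    then show ?thesis
    proof cases
      case 1
      then have "b \<noteq> u" using irrefl by auto
      then have "same_star E u b" using 1 same_star_iff[of u b] by blast
      then show ?thesis using leaf[OF 1] same_star_class_eq by metis
    next
      case 2
      then show ?thesis using leaf by metis
    qed
  qed
qed

lemma is_center_center: "is_center E {w. same_star E u w} (center E {w. same_star E u w})"
  unfolding center_def using ex_center by (rule someI_ex)

section \<open>Adjacency between different stars\<close>

text \<open>The edge \<open>cd\<close> crosses both cuts. If these have cut-rank at most 1, every
  further edge at \<open>x\<close> forces edges to \<open>c\<close> and \<open>d\<close>, until the
  neighbourhood of \<open>x\<close> is a clique containing \<open>c\<close> and
  \<open>d\<close>.\<close>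

lemma adjacent_imp_not_separated:
  assumes cd: "(c, d) \<in> E"
  shows "\<not> separated E {w. same_star E c w} {w. same_star E d w}"
proof
  assume "separated E {w. same_star E c w} {w. same_star E d w}"
  then consider (closed) X where "edge_closed E X" "c \<in> X" "d \<notin> X"
    | (split) x X where "\<not> edge_closed E {x}" "x \<notin> X" "split_set E X" "split_set E (insert x X)"
      "{w. same_star E c w} \<subseteq> X" "{w. same_star E d w} \<inter> insert x X = {}"
    unfolding separated_def using same_star_refl by blast
  then show False
  proof cases
    case closed
    then show False using cd by (auto simp: edge_closed_def)
  next
    case split
    have c: "c \<in> X" and d: "d \<notin> X" "d \<noteq> x" and ns: "\<not> same_star E c x" "\<not> same_star E d x"
      using split same_star_refl by auto
    have xc: "x \<noteq> c" using c split by auto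
    \<comment> \<open>The edge \<open>xw\<close> crosses the cut of \<open>X\<close> if
      \<open>w\<close> is in \<open>X\<close>, and that of \<open>insert x X\<close> otherwise.
      Comparing it with \<open>cd\<close> yields a four-cycle on \<open>c\<close>, \<open>d\<close>,
      \<open>x\<close>, \<open>w\<close>, whose two chords are also edges.\<close>
    have *: "(x, c) \<in> E \<and> (x, d) \<in> E \<and> (w, c) \<in> E \<and> (w, d) \<in> E"
      if w: "(x, w) \<in> E" "w \<noteq> c" "w \<noteq> d" for w
    proof (cases "w \<in> X")
      case True
      have wx: "(w, x) \<in> E" using w sym by blast
      have "(w, d) \<in> E" "(c, x) \<in> E"
        using split(3) True c d split(2) wx cd unfolding split_set_def by metis+
      then show ?thesis
        using four_cycle_chord[of c d w x] four_cycle_chord[of d w x c] cd wx w d xc sym by metis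
    next
      case False
      have "w \<noteq> x" using w irrefl by auto
      then have "(x, d) \<in> E" "(c, w) \<in> E"
        using split(4) False c d split(2) w cd unfolding split_set_def by (metis insert_iff)+
      then show ?thesis
        using four_cycle_chord[of c d x w] four_cycle_chord[of d x w c] cd w d xc sym by metis
    qed
    \<comment> \<open>\<open>x\<close> belongs to neither star, so it is a leaf at neither
      \<open>c\<close> nor \<open>d\<close>. Together with the previous fact this makes
      \<open>x\<close> adjacent to both.\<close>
    have nleaf: "E `` {x} \<noteq> {c}" "E `` {x} \<noteq> {d}"
      using ns same_star_iff[of c x] same_star_iff[of d x] xc d by auto
    have "\<exists>w. (x, w) \<in> E" using split(1) by (auto simp: edge_closed_def)
    with nleaf * have "(x, c) \<in> E" "(x, d) \<in> E" unfolding leaf_nbr_iff by metis+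
    moreover have "c \<noteq> d" using cd irrefl by auto
    ultimately obtain u v where uv: "(x, u) \<in> E" "(x, v) \<in> E" "u \<noteq> v" "(u, v) \<notin> E"
      using nonsimplicial by metis
    \<comment> \<open>If \<open>u\<close> and \<open>v\<close> both differ from \<open>c\<close> and
      \<open>d\<close>, then \<open>uv\<close> is a chord of the four-cycle \<open>u\<close>,
      \<open>x\<close>, \<open>v\<close>, \<open>c\<close>; otherwise \<open>uv\<close> is an edge
      by the facts above.\<close>
    show False
    proof (cases "{u, v} \<inter> {c, d} = {}")
      case True
      then show False
        using *[of u] *[of v] four_cycle_chord[of u x v c] uv sym xc
        by (metis disjoint_insert(1) insert_iff)
    next
      case False
      then show False using *[of u] *[of v] uv sym cd by blast
    qed
  qed
qed

text \<open>Take for \<open>e\<close> the last neighbour of \<open>c\<close> on a walk from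
  \<open>c\<close> to \<open>d\<close>, and for \<open>p\<close> its successor. The walk meets no
  neighbour of \<open>c\<close> after \<open>e\<close>, so it does not return to
  \<open>e\<close>.\<close>

lemma separating_nbr:
  assumes "(c, d) \<in> E\<^sup>*" "c \<noteq> d" "(c, d) \<notin> E"
  shows "\<exists>e p. (c, e) \<in> E \<and> (e, p) \<in> E \<and> p \<noteq> c \<and> (c, p) \<notin> E \<and> (p, d) \<in> (avoiding E e)\<^sup>*"
  using assms
proof (induction rule: rtrancl_induct)
  case (step y z)
  show ?case
  proof (cases "(c, y) \<in> E")
    case True
    then show ?thesis using step by blast
  next
    case False
    with step have "c \<noteq> y" by auto
    with step False obtain e p where e: "(c, e) \<in> E" "(e, p) \<in> E" "p \<noteq> c" "(c, p) \<notin> E"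
      "(p, y) \<in> (avoiding E e)\<^sup>*" by blast
    have "(y, z) \<in> avoiding E e" using step False e by (auto simp: avoiding_def)
    with e show ?thesis by (meson rtrancl.rtrancl_into_rtrancl)
  qed
qed simp

lemma sym_avoiding_rtrancl: "(x, y) \<in> (avoiding E e)\<^sup>* \<Longrightarrow> (y, x) \<in> (avoiding E e)\<^sup>*"
  by (rule symD[OF sym_rtrancl]) (auto simp: sym_def avoiding_def sym)

text \<open>In different components, the component of \<open>c\<close> separates. Otherwise use the
  vertex \<open>e\<close> of \<open>separating_nbr\<close> and the part of \<open>c\<close> after
  deleting \<open>e\<close>: if \<open>d\<close> were in it, \<open>c\<close> and \<open>p\<close>
  would be joined avoiding \<open>e\<close>, so \<open>cycle_chord\<close> would make them
  adjacent.\<close>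

lemma not_adjacent_imp_separated:
  assumes c: "is_center E {w. same_star E c w} c" and d: "is_center E {w. same_star E d w} d"
    and nsim: "\<not> same_star E c d" and nadj: "(c, d) \<notin> E"
  shows "separated E {w. same_star E c w} {w. same_star E d w}"
proof -
  have leafc: "(w, c) \<in> E" "\<And>y. (w, y) \<in> E \<Longrightarrow> y = c" if "same_star E c w" "w \<noteq> c" for w
    using c that by (auto simp: is_center_def)
  have leafd: "(w, d) \<in> E" "\<And>y. (w, y) \<in> E \<Longrightarrow> y = d" if "same_star E d w" "w \<noteq> d" for w
    using d that by (auto simp: is_center_def)
  show ?thesis
  proof (cases "(c, d) \<in> E\<^sup>*")
    case False
    let ?X = "E\<^sup>* `` {c}"
    have "edge_closed E ?X" by (auto simp: edge_closed_def)
    moreover have "{w. same_star E c w} \<subseteq> ?X" using leafc sym by blast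
    moreover have "{w. same_star E d w} \<inter> ?X = {}"
      using leafd False by (auto dest: rtrancl_into_rtrancl)
    ultimately show ?thesis unfolding separated_def by blast
  next
    case True
    have "c \<noteq> d" using nsim same_star_refl by auto
    then obtain e p where e: "(c, e) \<in> E" "(e, p) \<in> E" "p \<noteq> c" "(c, p) \<notin> E"
      "(p, d) \<in> (avoiding E e)\<^sup>*" using separating_nbr True nadj by blast
    let ?X = "(avoiding E e)\<^sup>* `` {c}"
    have dX: "d \<notin> ?X"
    proof
      assume "d \<in> ?X"
      then have "(c, p) \<in> (avoiding E e)\<^sup>*"
        using e(5) sym_avoiding_rtrancl by (meson Image_singleton_iff rtrancl_trans)
      then show False using cycle_chord[of e c p] e sym by blast
    qed
    have ec: "e \<noteq> c" using e irrefl by auto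
    have eX: "e \<notin> ?X"
    proof
      assume "e \<in> ?X"
      then show False using ec by (auto simp: avoiding_def elim: rtranclE)
    qed
    \<comment> \<open>Edges leaving \<open>?X\<close> all end in \<open>e\<close>, so edges leaving
      \<open>insert e ?X\<close> all start in \<open>e\<close>. Hence both sets have cut-rank at
      most 1.\<close>
    have out: "b = e" if "a \<in> ?X" "b \<notin> ?X" "(a, b) \<in> E" for a b
    proof (rule ccontr)
      assume "b \<noteq> e"
      moreover have "a \<noteq> e" using that eX by auto
      ultimately have "(a, b) \<in> avoiding E e" using that by (auto simp: avoiding_def)
      then show False using that by (auto dest: rtrancl_into_rtrancl)
    qed
    have 1: "split_set E ?X" unfolding split_set_def using out by blast
    have 2: "split_set E (insert e ?X)" unfolding split_set_def using out by blast
    have 3: "\<not> edge_closed E {e}" using e irrefl by (auto simp: edge_closed_def)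
    have 4: "{w. same_star E c w} \<subseteq> ?X"
    proof
      fix w assume "w \<in> {w. same_star E c w}"
      then have w: "same_star E c w" by simp
      show "w \<in> ?X"
      proof (cases "w = c")
        case False
        have "w \<noteq> e" using leafc(2)[OF w False] e by auto
        then have "(c, w) \<in> avoiding E e" using leafc(1)[OF w False] ec sym by (auto simp: avoiding_def)
        then show ?thesis by auto
      qed simp
    qed
    have 5: "w \<notin> insert e ?X" if w: "same_star E d w" for w
    proof (cases "w = d")
      case True
      then show ?thesis using dX e nadj by auto
    next
      case False
      have "w \<noteq> e" using leafd(2)[OF w False] e \<open>c \<noteq> d\<close> sym by blast
      moreover have "w \<notin> ?X"
        using out[OF _ dX leafd(1)[OF w False]] e nadj by blast
      ultimately show ?thesis by simp
    qed
    show ?thesis unfolding separated_def using 1 2 3 4 5 eX by blast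
  qed
qed

text \<open>Apart from the choice of centers, the right-hand side depends on \<open>E\<close> only
  through \<open>edge_closed\<close> and \<open>split_set\<close>. This is what lets the cut-rank
  determine the graph up to exchanging centers.\<close>

lemma edge_iff:
  "(u, v) \<in> E \<longleftrightarrow>
    (if same_star E u v then u \<noteq> v \<and> (u = center E {w. same_star E u w} \<or> v = center E {w. same_star E u w})
     else u = center E {w. same_star E u w} \<and> v = center E {w. same_star E v w} \<and>
       \<not> separated E {w. same_star E u w} {w. same_star E v w})"
proof -
  define cu where "cu = center E {w. same_star E u w}"
  define cv where "cv = center E {w. same_star E v w}"
  have cu: "is_center E {w. same_star E u w} cu" and cv: "is_center E {w. same_star E v w} cv"
    unfolding cu_def cv_def by (rule is_center_center)+
  have lu: "same_star E u w \<Longrightarrow> w \<noteq> cu \<Longrightarrow> E `` {w} = {cu}" for w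
    using cu by (auto simp: is_center_def)
  have lv: "same_star E v w \<Longrightarrow> w \<noteq> cv \<Longrightarrow> E `` {w} = {cv}" for w
    using cv by (auto simp: is_center_def)
  have s: "same_star E u cu" "same_star E v cv" using cu cv by (auto simp: is_center_def)
  show ?thesis
  proof (cases "same_star E u v")
    case True
    then show ?thesis unfolding cu_def[symmetric] cv_def[symmetric]
      using lu[of u] lu[of v] same_star_refl[of u] sym irrefl unfolding leaf_nbr_iff by metis
  next
    case False
    have "u = cu \<and> v = cv \<and> \<not> separated E {w. same_star E u w} {w. same_star E v w}" if "(u, v) \<in> E"
      using that lu[of u] lv[of v] s same_star_refl False sym same_star_commute adjacent_imp_not_separated
      unfolding leaf_nbr_iff by metis
    moreover have "(u, v) \<in> E" if "u = cu" "v = cv" "\<not> separated E {w. same_star E u w} {w. same_star E v w}"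
      using not_adjacent_imp_separated[of u v] cu cv that False by metis
    ultimately show ?thesis unfolding cu_def[symmetric] cv_def[symmetric] using False by argo
  qed
qed

end

section \<open>Isomorphism from equal cut-rank data\<close>

text \<open>The last conclusion says that \<open>f\<close> moves only non-isolated vertices, and
  only to such; it later shows that \<open>f\<close> preserves the vertex set.\<close>

lemma iso_of_same_splits:
  assumes "block_relation E" "block_relation F"
    and closed: "\<And>X. edge_closed E X \<longleftrightarrow> edge_closed F X"
    and split: "\<And>X. split_set E X \<longleftrightarrow> split_set F X"
  obtains f where "\<And>u. f (f u) = u" "\<And>u v. (u, v) \<in> E \<longleftrightarrow> (f u, f v) \<in> F"
    "\<And>u. f u = u \<or> (u \<in> Domain E \<and> f u \<in> Domain E)"
proof -
  interpret E: block_relation E by fact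
  interpret F: block_relation F by fact
  have sim: "same_star E = same_star F" by (intro ext) (simp add: same_star_def closed split)
  have sep: "separated E = separated F" by (intro ext) (simp add: separated_def closed split)
  define c where "c u = center E {w. same_star E u w}" for u
  define d where "d u = center F {w. same_star E u w}" for u
  \<comment> \<open>In each class, \<open>f\<close> swaps the center \<open>c u\<close> for
    \<open>E\<close> with the center \<open>d u\<close> for \<open>F\<close>; it fixes the class
    pointwise if they coincide.\<close>
  define f where "f u = (if u = c u then d u else if u = d u then c u else u)" for u
  have sc: "same_star E u (c u)" for u
    using E.is_center_center[of u] by (auto simp: is_center_def c_def)
  have sd: "same_star E u (d u)" for u
    using F.is_center_center[of u] by (auto simp: is_center_def d_def sim)
  have sf: "same_star E u (f u)" for u by (simp add: f_def sc sd E.same_star_refl)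
  have eq: "c u = c v" "d u = d v" if "same_star E u v" for u v
    using E.same_star_class_eq[OF that] by (simp_all add: c_def d_def)
  have cf: "c (f u) = c u" "d (f u) = d u" for u using eq[OF sf] by metis+
  have inv: "f (f u) = u" for u
    unfolding f_def[of "f u"] cf by (simp add: f_def)
  have cls: "{w. same_star E (f u) w} = {w. same_star E u w}" for u
    using E.same_star_class_eq[OF sf] by metis
  have simf: "same_star E (f u) (f v) \<longleftrightarrow> same_star E u v" for u v
    using sf E.same_star_trans E.same_star_commute by metis
  \<comment> \<open>As \<open>f\<close> preserves classes and carries \<open>E\<close>-centers to
    \<open>F\<close>-centers, it matches the two instances of \<open>edge_iff\<close>.\<close>
  have fd: "f u = d u \<longleftrightarrow> u = c u" for u by (auto simp: f_def)
  have fd': "f v = d u \<longleftrightarrow> v = c u" if "same_star E u v" for u v using fd[of v] eq[OF that] by simp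
  have ff: "f u = f v \<longleftrightarrow> u = v" for u v using inv by metis
  have edge: "(u, v) \<in> E \<longleftrightarrow> (f u, f v) \<in> F" for u v
    unfolding E.edge_iff[of u v] F.edge_iff[of "f u" "f v"] sim[symmetric] sep[symmetric] cls simf
      c_def[symmetric] d_def[symmetric] fd ff using fd' by auto
  have "f u = u \<or> (u \<in> Domain E \<and> f u \<in> Domain E)" for u
    using sf[of u] by (auto simp: same_star_def edge_closed_def)
  with inv edge show ?thesis using that by blast
qed

section \<open>Cycles in block graphs\<close>

text \<open>When a step returns to a vertex already on the chain, the chain is cut off at its
  earlier occurrence.\<close>

lemma rtrancl_distinct_chain:
  assumes "(x, y) \<in> R\<^sup>*"
  obtains xs where "xs \<noteq> []" "hd xs = x" "last xs = y" "distinct xs"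
    "successively (\<lambda>a b. (a, b) \<in> R) xs"
proof -
  have "\<exists>xs. xs \<noteq> [] \<and> hd xs = x \<and> last xs = y \<and> distinct xs \<and> successively (\<lambda>a b. (a, b) \<in> R) xs"
    using assms
  proof (induction rule: rtrancl_induct)
    case base
    show ?case by (rule exI[of _ "[x]"]) simp
  next
    case (step y z)
    then obtain xs where xs: "xs \<noteq> []" "hd xs = x" "last xs = y" "distinct xs"
      "successively (\<lambda>a b. (a, b) \<in> R) xs" by blast
    show ?case
    proof (cases "z \<in> set xs")
      case True
      then obtain as bs where "xs = as @ z # bs" by (meson split_list)
      with xs show ?thesis
        by (intro exI[of _ "as @ [z]"]) (auto simp: successively_append_iff hd_append split: if_splits)
    next
      case False
      with xs step show ?thesis
        by (intro exI[of _ "xs @ [z]"]) (auto simp: successively_append_iff)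
    qed
  qed
  then show ?thesis using that by blast
qed

text \<open>Restricting the relation to the chain itself makes the result usable in the subgraph
  induced by the chain.\<close>

lemma chain_hd_rtrancl:
  assumes "successively (\<lambda>a b. (a, b) \<in> R) xs" "y \<in> set xs"
  shows "(hd xs, y) \<in> (R \<inter> set xs \<times> set xs)\<^sup>*"
  using assms
proof (induction xs arbitrary: y rule: rev_induct)
  case (snoc z xs)
  let ?T = "R \<inter> set (xs @ [z]) \<times> set (xs @ [z])"
  have mono: "(R \<inter> set xs \<times> set xs)\<^sup>* \<subseteq> ?T\<^sup>*" by (rule rtrancl_mono) auto
  show ?case
  proof (cases "xs = []")
    case False
    then have hd: "hd (xs @ [z]) = hd xs" by simp
    have old: "(hd xs, w) \<in> ?T\<^sup>*" if "w \<in> set xs" for w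
      using snoc.IH snoc.prems(1) that mono by (auto simp: successively_append_iff)
    have "(last xs, z) \<in> ?T" using snoc.prems(1) False by (auto simp: successively_append_iff)
    then have "(hd xs, z) \<in> ?T\<^sup>*" using old[of "last xs"] False by (auto intro: rtrancl_into_rtrancl)
    then show ?thesis using old snoc.prems(2) hd by auto
  qed (use snoc.prems in auto)
qed simp

context graph
begin

lemma arcs_ends_induce: "arcs_ends (G \<restriction> S) = arcs_ends G \<inter> S \<times> S"
  by (auto simp: arcs_ends_conv)

lemma induced_graph:
  assumes "S \<subseteq> verts G" shows "graph (G \<restriction> S)"
proof -
  interpret S: digraph "G \<restriction> S" using induced_induce[OF assms] by (rule digraphI_induced)
  show ?thesis
    using induced_graph_imp_symmetric[OF sym_arcs induced_induce[OF assms]] by (rule S.graphI)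
qed

lemma chain_strongly_connected:
  assumes "xs \<noteq> []" "set xs \<subseteq> verts G" "successively (\<lambda>a b. (a, b) \<in> arcs_ends G) xs"
  shows "strongly_connected (G \<restriction> set xs)"
proof -
  interpret S: graph "G \<restriction> set xs" using assms by (intro induced_graph)
  have hd: "hd xs \<rightarrow>\<^sup>*\<^bsub>G \<restriction> set xs\<^esub> v" if "v \<in> set xs" for v
    using chain_hd_rtrancl[OF assms(3) that] assms(1)
    by (subst S.reachable_conv') (auto simp: arcs_ends_induce)
  show ?thesis
    using assms(1) hd S.symmetric_reachable'[OF hd]
    by (intro strongly_connectedI) (auto intro: S.reachable_trans)
qed

lemma strongly_connected_imp_connected: "strongly_connected G \<Longrightarrow> connected G"
  unfolding connected_def strongly_connected_def
  by (simp add: reachable_mk_symmetric_eq[OF sym_arcs])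

lemma del_vert_induce: "pre_digraph.del_vert (G \<restriction> S) v = G \<restriction> (S - {v})"
  unfolding pre_digraph.del_vert_def induce_subgraph_def by auto

section \<open>Blocks and chords of cycles\<close>

text \<open>By finiteness some candidate above \<open>H\<close> has the largest total number of
  vertices and arcs; any candidate containing it has the same counts and so equals it.\<close>

lemma ex_max_subgraph:
  assumes "subgraph H G" "P H"
  shows "\<exists>B. max_subgraph P B \<and> subgraph H B"
proof -
  define Q where "Q B \<longleftrightarrow> subgraph B G \<and> P B \<and> subgraph H B" for B
  define m where "m B = card (verts B) + card (arcs B)" for B :: "('a, 'b) pre_digraph"
  have le: "verts B \<subseteq> verts G" "arcs B \<subseteq> arcs G" if "Q B" for B
    using that by (auto simp: Q_def)
  have "Q H" using assms unfolding Q_def by (auto intro: wf_digraph.subgraph_refl)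
  moreover have "\<forall>B. Q B \<longrightarrow> m B \<le> m G"
    using le by (auto simp: m_def intro!: add_mono card_mono)
  ultimately obtain B where B: "Q B" "\<And>B'. Q B' \<Longrightarrow> m B' \<le> m B"
    using ex_has_greatest_nat[of Q H m "Suc (m G)"] by (auto simp: less_Suc_eq_le)
  have "B' = B" if "subgraph B B'" "subgraph B' G" "P B'" for B'
  proof -
    have "Q B'" using that B(1) unfolding Q_def by (auto intro: subgraph_trans)
    have sub: "verts B \<subseteq> verts B'" "arcs B \<subseteq> arcs B'" "tail B = tail B'" "head B = head B'"
      using that(1) by (auto simp: subgraph_def compatible_def)
    have fin: "finite (verts B')" "finite (arcs B')"
      using le[OF \<open>Q B'\<close>] by (auto intro: finite_subset)
    have "card (verts B) \<le> card (verts B')" "card (arcs B) \<le> card (arcs B')"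
      using sub fin by (auto intro: card_mono)
    moreover have "m B' \<le> m B" using B(2) \<open>Q B'\<close> by blast
    ultimately have "card (verts B) = card (verts B')" "card (arcs B) = card (arcs B')"
      by (auto simp: m_def)
    then have "verts B = verts B'" "arcs B = arcs B'"
      using card_subset_eq[OF fin(1) sub(1)] card_subset_eq[OF fin(2) sub(2)] by simp_all
    then show ?thesis using sub by (intro pre_digraph.equality) auto
  qed
  then show ?thesis using B(1) unfolding Q_def max_subgraph_def by blast
qed

text \<open>Such an \<open>S\<close> induces a connected subgraph without cut vertices. It therefore
  lies in a block, and blocks are complete.\<close>

lemma block_graph_biconnected_adjacent:
  assumes "block_graph G" and S: "S \<subseteq> verts G" "strongly_connected (G \<restriction> S)"
    and del: "\<And>v. v \<in> S \<Longrightarrow> strongly_connected (G \<restriction> (S - {v}))"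
    and uv: "u \<in> S" "v \<in> S" "u \<noteq> v"
  shows "u \<rightarrow> v"
proof -
  interpret S: graph "G \<restriction> S" using S(1) by (rule induced_graph)
  have "\<not> cut_vertex (G \<restriction> S) w" for w
  proof
    assume w: "cut_vertex (G \<restriction> S) w"
    then have "w \<in> S" by (simp add: cut_vertex_def)
    interpret W: graph "G \<restriction> (S - {w})" using S(1) by (intro induced_graph) auto
    \<comment> \<open>There is one component before and one after deleting \<open>w\<close>, so the
      number does not grow.\<close>
    have "pre_digraph.sccs (G \<restriction> S) = {G \<restriction> S}" using S(2) S.strongly_connected_eq_iff by blast
    moreover have "pre_digraph.sccs (G \<restriction> (S - {w})) = {G \<restriction> (S - {w})}"
      using del[OF \<open>w \<in> S\<close>] W.strongly_connected_eq_iff by blast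
    ultimately show False using w by (simp add: cut_vertex_def del_vert_induce)
  qed
  moreover have "connected (G \<restriction> S)" using S(2) by (rule S.strongly_connected_imp_connected)
  moreover have "subgraph (G \<restriction> S) G" using S(1) by (intro induced_imp_subgraph induced_induce)
  ultimately obtain B where B: "block G B" "subgraph (G \<restriction> S) B"
    using ex_max_subgraph[of "G \<restriction> S" "\<lambda>B. graph B \<and> connected B \<and> \<not> (\<exists>v. cut_vertex B v)"]
      S.graph_axioms unfolding block_def by blast
  then obtain n where "complete_digraph n B" using assms(1) by (auto simp: block_graph_def)
  moreover have "u \<in> verts B" "v \<in> verts B" using B(2) uv by (auto dest!: subgraph_imp_subverts)
  ultimately have "u \<rightarrow>\<^bsub>B\<^esub> v" using uv(3) by (auto simp: complete_digraph_def)
  then show ?thesis using B(1) by (auto simp: block_def max_subgraph_def intro: adj_mono)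
qed

text \<open>A path from \<open>c\<close> to \<open>z\<close> avoiding \<open>e\<close> forms a cycle
  together with \<open>e\<close>, and a cycle stays connected when any one vertex is
  deleted.\<close>

lemma block_graph_cycle_chord:
  assumes "block_graph G" "e \<rightarrow> c" "e \<rightarrow> z" "c \<noteq> z"
    and path: "(c, z) \<in> (avoiding (arcs_ends G) e)\<^sup>*"
  shows "c \<rightarrow> z"
proof -
  let ?P = "\<lambda>a b. (a, b) \<in> arcs_ends G"
  obtain xs where xs: "xs \<noteq> []" "hd xs = c" "last xs = z" "distinct xs"
    "successively (\<lambda>a b. (a, b) \<in> avoiding (arcs_ends G) e) xs"
    using path by (rule rtrancl_distinct_chain)
  have chain: "successively ?P xs" using xs(5) by (rule successively_mono) (auto simp: avoiding_def)
  have ec: "c \<noteq> e" "e \<noteq> z" using assms adj_not_same by auto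
  have "x \<in> verts G \<and> x \<noteq> e" if "x \<in> set xs" for x
  proof -
    have "(c, x) \<in> (avoiding (arcs_ends G) e \<inter> set xs \<times> set xs)\<^sup>*"
      using chain_hd_rtrancl[OF xs(5) that] xs(2) by simp
    then show ?thesis
      by (cases rule: rtranclE) (use assms ec in \<open>auto simp: avoiding_def dest: adj_in_verts\<close>)
  qed
  then have xsV: "set xs \<subseteq> verts G" "e \<notin> set xs" by auto
  have eV: "e \<in> verts G" using assms adj_in_verts by blast
  have ends: "c \<in> set xs" "z \<in> set xs" using xs by auto
  have full: "successively ?P (e # xs)"
    using chain xs(1,2) assms(2) by (simp add: successively_Cons)
  show ?thesis
  proof (rule block_graph_biconnected_adjacent[OF assms(1), where S = "set (e # xs)"])
    show "set (e # xs) \<subseteq> verts G" using xsV eV by simp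
    show "strongly_connected (G \<restriction> set (e # xs))"
      using full xsV eV by (intro chain_strongly_connected) auto
    fix v assume "v \<in> set (e # xs)"
    then consider "v = e" | "v \<in> set xs" "v \<noteq> e" using xsV by auto
    then show "strongly_connected (G \<restriction> (set (e # xs) - {v}))"
    proof cases
      case 1
      then have "set (e # xs) - {v} = set xs" using xsV by auto
      then show ?thesis using chain_strongly_connected[OF xs(1) xsV(1) chain] by simp
    next
      case 2
      then obtain as bs where ab: "xs = as @ v # bs" by (meson split_list)
      \<comment> \<open>Without \<open>v\<close> the cycle is a path: start just after
        \<open>v\<close>, pass through \<open>z\<close> and \<open>e\<close> to \<open>c\<close>,
        and stop just before \<open>v\<close>. If \<open>v\<close> is \<open>z\<close> or
        \<open>c\<close>, then \<open>bs\<close> or \<open>as\<close> is empty.\<close>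
      have eq: "set (e # xs) - {v} = set (bs @ e # as)" using ab xs(4) 2 by auto
      have "as = [] \<or> hd as = c" using ab xs(2) by (cases as) auto
      moreover have "bs = [] \<or> last bs = z" using ab xs(3) by (cases "bs = []") auto
      moreover have "z \<rightarrow> e" using assms(3) graph_symmetric by blast
      ultimately have "successively ?P (bs @ e # as)"
        using chain assms(2) ab by (auto simp: successively_append_iff successively_Cons)
      then show ?thesis unfolding eq
        using xsV eV ab by (intro chain_strongly_connected) auto
    qed
  qed (use ends assms(4) in auto)
qed

end

section \<open>Local complementation\<close>

text \<open>The biconditional is addition over GF(2) of the complete graph on the neighbourhood of
  \<open>v\<close>.\<close>

definition local_complement_rel :: "'a rel \<Rightarrow> 'a \<Rightarrow> 'a rel" where
  "local_complement_rel E v =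
     {(x, y). x \<noteq> y \<and> ((x, y) \<in> E \<longleftrightarrow> \<not> ((v, x) \<in> E \<and> (v, y) \<in> E))}"

text \<open>For the involution: \<open>v\<close> is not its own neighbour, so its neighbourhood
  stays the same and the second application toggles the same pairs back.\<close>

lemma
  assumes "sym E" "irrefl E"
  shows sym_local_complement_rel: "sym (local_complement_rel E v)"
    and irrefl_local_complement_rel: "irrefl (local_complement_rel E v)"
    and local_complement_rel_invol: "local_complement_rel (local_complement_rel E v) v = E"
    and parcs_local_complement_rel: "E = parcs G \<Longrightarrow>
      parcs (local_complement G v) = local_complement_rel E v"
proof -
  have s: "(x, y) \<in> E \<longleftrightarrow> (y, x) \<in> E" and i: "(x, x) \<notin> E" for x y
    using assms by (auto simp: sym_def irrefl_def)
  show "sym (local_complement_rel E v)"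
    using s unfolding sym_def local_complement_rel_def by auto
  show "irrefl (local_complement_rel E v)" by (auto simp: irrefl_def local_complement_rel_def)
  show "local_complement_rel (local_complement_rel E v) v = E"
    using i unfolding local_complement_rel_def by auto
  show "parcs (local_complement G v) = local_complement_rel E v" if "E = parcs G"
    using i that unfolding local_complement_def local_complement_rel_def neighbors_def by auto
qed

lemma edge_closed_local_complement_rel:
  assumes "sym E" "edge_closed E X" shows "edge_closed (local_complement_rel E v) X"
  using assms unfolding edge_closed_def local_complement_rel_def sym_def by blast

text \<open>On the cut matrix of \<open>X\<close>, local complementation adds the row of
  \<open>v\<close> to the rows of its neighbours if \<open>v\<close> is in \<open>X\<close>, and
  does the same with columns otherwise. Neither changes the rank.\<close>

lemma split_set_local_complement_rel:
  assumes "sym E" "split_set E X" shows "split_set (local_complement_rel E v) X"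
  unfolding split_set_def
proof (intro ballI allI impI, elim conjE)
  fix a a' b b'
  assume X: "a \<in> X" "a' \<in> X" "b \<notin> X" "b' \<notin> X"
    and ab: "(a, b) \<in> local_complement_rel E v" "(a', b') \<in> local_complement_rel E v"
  have ne: "a \<noteq> b" "a \<noteq> b'" "a' \<noteq> b'" using X by auto
  \<comment> \<open>All 2 by 2 minors of the cut matrix vanish.\<close>
  have minor: "(p, r) \<in> E \<and> (p', r') \<in> E \<longleftrightarrow> (p, r') \<in> E \<and> (p', r) \<in> E"
    if "p \<in> X" "p' \<in> X" "r \<notin> X" "r' \<notin> X" for p p' r r'
    using assms(2) that unfolding split_set_def by blast
  have s: "(x, y) \<in> E \<longleftrightarrow> (y, x) \<in> E" for x y using assms(1) by (auto simp: sym_def)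
  show "(a, b') \<in> local_complement_rel E v"
  proof (cases "v \<in> X")
    case True
    show ?thesis
      using ab ne minor[of a a' b b'] minor[of a v b b'] minor[of a' v b b'] X True
      unfolding local_complement_rel_def by auto
  next
    case False
    show ?thesis
      using ab ne minor[of a a' b b'] minor[of a a' b v] minor[of a a' b' v] s[of v a] s[of v a'] X False
      unfolding local_complement_rel_def by auto
  qed
qed

lemma locally_equivalent_invariants:
  assumes "locally_equivalent G H" "sym (parcs G)" "irrefl (parcs G)"
  shows "pverts H = pverts G \<and> sym (parcs H) \<and> irrefl (parcs H) \<and>
    (\<forall>X. edge_closed (parcs H) X \<longleftrightarrow> edge_closed (parcs G) X) \<and>
    (\<forall>X. split_set (parcs H) X \<longleftrightarrow> split_set (parcs G) X)"
  using assms(1) unfolding locally_equivalent_def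
proof (induction rule: rtranclp_induct)
  case base
  show ?case using assms by simp
next
  case (step K L)
  then obtain v where L: "L = local_complement K v" by blast
  have K: "sym (parcs K)" "irrefl (parcs K)" using step.IH by auto
  have P: "parcs L = local_complement_rel (parcs K) v"
    using L parcs_local_complement_rel[OF K] by simp
  \<comment> \<open>Since the complementation is an involution, the one-directional preservation
    lemmas give equivalences.\<close>
  have K': "parcs K = local_complement_rel (parcs L) v"
    using P local_complement_rel_invol[OF K] by simp
  have sL: "sym (parcs L)" "irrefl (parcs L)"
    unfolding P by (rule sym_local_complement_rel[OF K] irrefl_local_complement_rel[OF K])+
  have "edge_closed (parcs L) X \<longleftrightarrow> edge_closed (parcs K) X" for X
    using edge_closed_local_complement_rel[OF K(1)] edge_closed_local_complement_rel[OF sL(1)] P K'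
    by metis
  moreover have "split_set (parcs L) X \<longleftrightarrow> split_set (parcs K) X" for X
    using split_set_local_complement_rel[OF K(1)] split_set_local_complement_rel[OF sL(1)] P K'
    by metis
  moreover have "pverts L = pverts K" by (simp add: L local_complement_def)
  ultimately show ?case using step.IH sL by simp
qed

section \<open>Transfer to pair graphs\<close>

lemma block_relation_parcs:
  fixes G :: "'a pair_pre_digraph"
  assumes "pair_graph G" "block_graph G" "\<not> (\<exists>v. simplicial G v \<and> degree G v \<ge> 2)"
  shows "block_relation (parcs G)"
proof -
  interpret pair_graph G by fact
  show ?thesis
  proof
    fix x y show "(x, y) \<in> parcs G \<Longrightarrow> (y, x) \<in> parcs G" using graph_symmetric by blast
  next
    fix x show "(x, x) \<notin> parcs G" using no_loops' by blast
  next
    fix e c z assume "(e, c) \<in> parcs G" "(e, z) \<in> parcs G" "c \<noteq> z" "(c, z) \<in> (avoiding (parcs G) e)\<^sup>*"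
    then show "(c, z) \<in> parcs G"
      using block_graph_cycle_chord[OF assms(2), of e c z] by simp
  next
    fix x y z assume xyz: "(x, y) \<in> parcs G" "(x, z) \<in> parcs G" "y \<noteq> z"
    have N: "neighbors G x \<subseteq> pverts G" by (auto simp: neighbors_def dest: in_arcsD2)
    have "{y, z} \<subseteq> neighbors G x" using xyz by (simp add: neighbors_def)
    then have "card {y, z} \<le> degree G x"
      unfolding degree_def using N finite_subset pair_finite_verts by (intro card_mono) blast+
    then have "\<not> simplicial G x" using assms(3) xyz by auto
    then show "\<exists>u v. (x, u) \<in> parcs G \<and> (x, v) \<in> parcs G \<and> u \<noteq> v \<and> (u, v) \<notin> parcs G"
      using N xyz in_arcsD1 by (auto simp: simplicial_def clique_def neighbors_def)
  qed
qed

text \<open>Arcs of a pair graph are pairs of vertices, so the vertex map determines the arc map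
  \<open>map_prod f f\<close>.\<close>

lemma digraph_iso_pairI:
  fixes G :: "'a pair_pre_digraph" and H :: "'b pair_pre_digraph"
  assumes "pair_wf_digraph G" "bij_betw f (pverts G) (pverts H)"
    and "map_prod f f ` parcs G = parcs H"
  shows "digraph_iso G H"
proof -
  interpret pair_wf_digraph G by fact
  let ?h = "\<lparr>iso_verts = f, iso_arcs = map_prod f f, iso_head = snd, iso_tail = fst\<rparr>"
  have inj: "inj_on f (pverts G)" using assms(2) by (simp add: bij_betw_def)
  have "parcs G \<subseteq> pverts G \<times> pverts G" by (auto dest: in_arcsD1 in_arcsD2)
  then have "inj_on (map_prod f f) (parcs G)"
    using map_prod_inj_on[OF inj inj] inj_on_subset by blast
  then have "pre_digraph.digraph_isomorphism G ?h"
    using inj wf_digraph by (auto simp: pre_digraph.digraph_isomorphism_def)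
  moreover have "with_proj H = app_iso ?h G"
    using assms(2,3) by (simp add: app_iso_def with_proj_def bij_betw_def)
  ultimately show ?thesis unfolding digraph_iso_def by blast
qed

theorem theorem1p4:
  fixes G H :: "'a pair_pre_digraph"
  assumes "pair_graph G" and "pair_graph H"
    and "block_graph G" and "block_graph H"
    and "\<not> (\<exists>v. simplicial G v \<and> degree G v \<ge> 2)"
    and "\<not> (\<exists>v. simplicial H v \<and> degree H v \<ge> 2)"
    and "locally_equivalent G H"
  shows "digraph_iso G H"
proof -
  interpret G: pair_graph G by fact
  have bG: "block_relation (parcs G)" and bH: "block_relation (parcs H)"
    using assms by (auto intro: block_relation_parcs)
  have "sym (parcs G)" "irrefl (parcs G)"
    using block_relation.sym[OF bG] block_relation.irrefl[OF bG] by (auto simp: sym_def irrefl_def)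
  note inv = locally_equivalent_invariants[OF assms(7) this]
  obtain f where f: "\<And>u. f (f u) = u" "\<And>u v. (u, v) \<in> parcs G \<longleftrightarrow> (f u, f v) \<in> parcs H"
    "\<And>u. f u = u \<or> (u \<in> Domain (parcs G) \<and> f u \<in> Domain (parcs G))"
    using iso_of_same_splits[OF bG bH] inv by metis
  \<comment> \<open>A moved vertex goes to an endpoint of an arc of \<open>G\<close>, hence to a
    vertex of \<open>G\<close>.\<close>
  have fV: "f u \<in> pverts G" if "u \<in> pverts G" for u
    using f(3)[of u] that by (auto dest: G.in_arcsD1)
  show ?thesis
  proof (rule digraph_iso_pairI)
    show "pair_wf_digraph G" by unfold_locales
    show "bij_betw f (pverts G) (pverts H)"
      using inv fV f(1) by (intro bij_betw_byWitness[where f' = f]) auto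
    show "map_prod f f ` parcs G = parcs H"
    proof (intro equalityI subsetI)
      fix p assume "p \<in> parcs H"
      moreover obtain u v where "p = (u, v)" by (cases p)
      ultimately have "(f u, f v) \<in> parcs G" "p = map_prod f f (f u, f v)"
        using f(2)[of "f u" "f v"] f(1) by simp_all
      then show "p \<in> map_prod f f ` parcs G" by blast
    qed (use f(2) in auto)
  qed
qed

end
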